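(* The Kalman gain $K^*$ minimizes the smallest eigenvalue of $P_K$: $$K^*=\arg\min_{K\in\mathbb{R}^{n\times m}}\lambda_1^K.$$
   Context: Let $P\in\mathbb{R}^{n\times n}$ (prior covariance) and $R\in\mathbb{R}^{m\times m}$ (likelihood covariance) be symmetric and positive definite, and let $H\in\mathbb{R}^{m\times n}$ (measurement operator). The Kalman gain is $K^*=PH^\top(HPH^\top+R)^{-1}\in\mathbb{R}^{n\times m}$. For $K\in\mathbb{R}^{n\times m}$ set $P_K=(I-KH)P(I-KH)^\top+KRK^\top$, where $I$ is the $n\times n$ identity matrix; $P_K$ is symmetric and positive definite, and $P_{K^*}$ is the posterior covariance. Let $0<\lambda_1^K\le\dots\le\lambda_n^K$ be the eigenvalues of $P_K$ with multiplicity. The notation $K^*=\arg\min_K f(K)$ means that $K^*$ is a global minimizer: $f(K^* )\le f(K)$ for all $K\in\mathbb{R}^{n\times m}$. *)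

theory Defs
  imports
    "HOL-Analysis.Analysis"
    "HOL-Computational_Algebra.Polynomial"
    "HOL-Library.Multiset"
begin

text \<open>
  Conventions: \<open>real^'n^'m\<close> is the type of matrices with rows indexed by \<open>'m\<close> and columns
  indexed by \<open>'n\<close>.
\<close>

definition sym_pos_def :: "real^'n^'n \<Rightarrow> bool" where
  "sym_pos_def A \<longleftrightarrow> transpose A = A \<and> (\<forall>x. x \<noteq> 0 \<longrightarrow> x \<bullet> (A *v x) > 0)"

text \<open>The characteristic polynomial \<open>det (X I - A)\<close>, a determinant over the polynomial ring.\<close>

definition charpoly :: "real^'n^'n \<Rightarrow> real poly" where
  "charpoly A = det (\<chi> i j. (if i = j then [:0, 1:] else 0) - [:A $ i $ j:])"

text \<open>
  The real eigenvalues in increasing order, each repeated according to its multiplicity as a root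
  of the characteristic polynomial. For symmetric matrices all complex eigenvalues are real and
  algebraic and geometric multiplicities agree, so this is the full list
  \<open>\<lambda>\<^sub>1 \<le> \<dots> \<le> \<lambda>\<^sub>n\<close>.
\<close>

definition eigenvalues_asc :: "real^'n^'n \<Rightarrow> real list" where
  "eigenvalues_asc A = sorted_list_of_multiset (proots (charpoly A))"

text \<open>The \<open>k\<close>-th smallest eigenvalue, counted from \<open>k = 1\<close>; lists are indexed from 0.\<close>

definition nth_eigenvalue :: "nat \<Rightarrow> real^'n^'n \<Rightarrow> real" where
  "nth_eigenvalue k A = eigenvalues_asc A ! (k - 1)"

definition kalman_gain :: "real^'n^'n \<Rightarrow> real^'m^'m \<Rightarrow> real^'n^'m \<Rightarrow> real^'m^'n" where
  "kalman_gain P R H =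
     P ** transpose H ** matrix_inv (H ** P ** transpose H + R)"

definition gain_cov :: "real^'n^'n \<Rightarrow> real^'m^'m \<Rightarrow> real^'n^'m \<Rightarrow> real^'m^'n \<Rightarrow> real^'n^'n" where
  "gain_cov P R H K =
     (mat 1 - K ** H) ** P ** transpose (mat 1 - K ** H) + K ** R ** transpose K"

lemma poly_charpoly: "poly (charpoly A) x = det (mat x - A)"
  unfolding charpoly_def det_def
  by (auto simp: poly_sum poly_prod mat_def intro!: sum.cong prod.cong)

lemma poly_charpoly_eq_0_iff:
  "poly (charpoly A) x = 0 \<longleftrightarrow> (\<exists>v. v \<noteq> 0 \<and> A *v v = x *\<^sub>R v)"
proof -
  have m: "mat x *v v = x *\<^sub>R v" for v :: "real^'n"
    by (simp add: vec_eq_iff matrix_vector_mult_def mat_def if_distrib[of "\<lambda>y. y * _"] cong: if_cong)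
  have "poly (charpoly A) x = 0 \<longleftrightarrow> (\<exists>v. v \<noteq> 0 \<and> (mat x - A) *v v = 0)"
    unfolding poly_charpoly
    by (metis invertible_det_nz invertible_left_inverse matrix_left_invertible_ker)
  then show ?thesis
    by (auto simp: matrix_vector_mult_diff_rdistrib m)
qed

lemma charpoly_nonzero: "charpoly A \<noteq> 0"
proof
  assume "charpoly A = 0"
  then obtain v where v: "v \<noteq> 0" "A *v v = (onorm ((*v) A) + 1) *\<^sub>R v"
    using poly_charpoly_eq_0_iff[of A "onorm ((*v) A) + 1"] by auto
  have "norm (A *v v) \<le> onorm ((*v) A) * norm v" "0 \<le> onorm ((*v) A)"
    by (simp_all add: onorm onorm_pos_le matrix_vector_mul_bounded_linear)
  with v show False by simp
qed

lemma set_eigenvalues_asc: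
  "set (eigenvalues_asc A) = {x. \<exists>v. v \<noteq> 0 \<and> A *v v = x *\<^sub>R v}"
  by (simp add: eigenvalues_asc_def charpoly_nonzero poly_charpoly_eq_0_iff)

lemma count_eigenvalues_asc:
  "count (mset (eigenvalues_asc A)) x = order x (charpoly A)"
  by (simp add: eigenvalues_asc_def charpoly_nonzero)

end

theory Submission
  imports Defs
begin

text \<open>
  Write \<open>q\<^sub>K(x) = x \<bullet> P\<^sub>K x\<close>. The gain enters this quadratic form only through the
  vector \<open>u = K\<^sup>T x\<close>, and \<open>q\<^sub>K(x) = J\<^sub>x(u)\<close> where
  \<open>J\<^sub>x(u) = (x - H\<^sup>T u) \<bullet> P (x - H\<^sup>T u) + u \<bullet> R u\<close> is a convex quadratic function of \<open>u\<close>
  with Hessian \<open>2 S\<close>, \<open>S = H P H\<^sup>T + R\<close>. Its critical point solves \<open>S u = H P x\<close>, and the Kalman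
  gain is the matrix for which \<open>u = (K\<^sup>*)\<^sup>T x\<close> solves this equation for every \<open>x\<close> at once.
  Hence \<open>q\<close> at the Kalman gain is pointwise below \<open>q\<^sub>K\<close>
  (\<open>gain_cov_kalman_gain_le\<close>: the Loewner order).

  The smallest eigenvalue is monotone in the Loewner order, since it is the minimum of the
  quadratic form on the unit sphere (\<open>symmetric_min_eigenvector\<close>): at an eigenvector \<open>v\<close> for the
  smallest eigenvalue of \<open>P\<^sub>K\<close> the form \<open>q\<^sub>K\<close> takes the value \<open>\<lambda>\<^sub>1\<^sup>K |v|\<^sup>2\<close>, the Kalman form is
  no larger there, and it is bounded below by its own smallest eigenvalue times \<open>|v|\<^sup>2\<close>.
\<close>

lemma inner_matrix_vector_transpose:
  fixes A :: "real^'n^'m"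
  shows "x \<bullet> (A *v y) = (transpose A *v x) \<bullet> y"
  by (simp add: dot_lmul_matrix)

lemma inner_symmetric_matrix:
  fixes A :: "real^'n^'n"
  assumes "transpose A = A"
  shows "x \<bullet> (A *v y) = y \<bullet> (A *v x)"
  by (metis assms inner_commute inner_matrix_vector_transpose)

lemma transpose_add: "transpose (A + B) = transpose A + transpose B"
  by (simp add: transpose_def vec_eq_iff)

lemma transpose_diff: "transpose (A - B) = transpose A - transpose B"
  for A B :: "real^'n^'m"
  by (simp add: transpose_def vec_eq_iff)

text \<open>
  A minimizer \<open>v\<close> of the quadratic form on the unit sphere is an eigenvector: for the minimum \<open>m\<close>,
  the form of \<open>A - m I\<close> is nonnegative and vanishes at \<open>v\<close>, so moving from \<open>v\<close> against
  \<open>w = A v - m v\<close> would make it negative unless \<open>w = 0\<close>.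
\<close>

lemma symmetric_min_eigenvector:
  fixes A :: "real^'n^'n"
  assumes sym: "transpose A = A"
  obtains v m where "v \<noteq> 0" "A *v v = m *\<^sub>R v" "\<And>x. m * (x \<bullet> x) \<le> x \<bullet> (A *v x)"
proof -
  let ?S = "sphere (0 :: real^'n) 1"
  have "continuous_on ?S (\<lambda>x. x \<bullet> (A *v x))"
    by (intro continuous_intros matrix_vector_mult_linear_continuous_on)
  then obtain v where v: "v \<in> ?S" and min: "\<And>y. y \<in> ?S \<Longrightarrow> v \<bullet> (A *v v) \<le> y \<bullet> (A *v y)"
    using continuous_attains_inf[of ?S "\<lambda>x. x \<bullet> (A *v x)"] by auto
  define m where "m = v \<bullet> (A *v v)"
  have vv: "v \<bullet> v = 1"
    using v by (simp add: dot_square_norm)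
  have lower: "m * (x \<bullet> x) \<le> x \<bullet> (A *v x)" for x
  proof (cases "x = 0")
    case False
    define y where "y = (1 / norm x) *\<^sub>R x"
    have "y \<in> ?S" and x: "x = norm x *\<^sub>R y"
      using False by (simp_all add: y_def)
    have yy: "y \<bullet> y = 1"
      using \<open>y \<in> ?S\<close> by (simp add: dot_square_norm)
    have "x \<bullet> (A *v x) = (norm x)\<^sup>2 * (y \<bullet> (A *v y))" "x \<bullet> x = (norm x)\<^sup>2"
      by (subst x, subst (2) x, simp add: matrix_vector_mult_scaleR power2_eq_square,
          simp add: dot_square_norm)
    then show ?thesis
      using mult_left_mono[OF min[OF \<open>y \<in> ?S\<close>], of "(norm x)\<^sup>2"] by (simp add: m_def mult.commute)
  qed simp
  define w where "w = A *v v - m *\<^sub>R v"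
  define c where "c = w \<bullet> w"
  define d where "d = w \<bullet> (A *v w) - m * (w \<bullet> w)"
  have "d \<ge> 0" "c \<ge> 0"
    using lower[of w] by (simp_all add: d_def c_def)
  have Avv: "v \<bullet> (A *v v) = m" by (simp add: m_def)
  have wv: "w \<bullet> (A *v v) = c + m * (w \<bullet> v)"
  proof -
    have "A *v v = w + m *\<^sub>R v" by (simp add: w_def)
    then show ?thesis by (simp add: c_def inner_add_right)
  qed
  have quad: "0 \<le> t\<^sup>2 * d - 2 * t * c" for t
  proof -
    have "(v - t *\<^sub>R w) \<bullet> (A *v (v - t *\<^sub>R w)) - m * ((v - t *\<^sub>R w) \<bullet> (v - t *\<^sub>R w))
        = t\<^sup>2 * d - 2 * t * c"
      using wv inner_symmetric_matrix[OF sym, of v w]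
      by (simp add: matrix_vector_mult_diff_distrib matrix_vector_mult_scaleR inner_diff_left
          inner_diff_right Avv vv d_def inner_commute[of v w] algebra_simps power2_eq_square)
    then show ?thesis
      using lower[of "v - t *\<^sub>R w"] by linarith
  qed
  have "c = 0"
  proof (rule ccontr)
    assume "c \<noteq> 0"
    with \<open>c \<ge> 0\<close> have "c > 0" by simp
    \<comment> \<open>Up to the \<open>+ 1\<close>, which avoids division by zero, this is the minimizer of \<open>t\<^sup>2 d - 2 t c\<close>.\<close>
    define t where "t = c / (d + 1)"
    have "t > 0" "t * d < 2 * c"
      using \<open>c > 0\<close> \<open>d \<ge> 0\<close> by (simp_all add: t_def field_simps add_strict_increasing2)
    then have "t * (t * d - 2 * c) < 0"
      by (simp add: mult_pos_neg)
    then show False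
      using quad[of t] by (simp add: power2_eq_square algebra_simps)
  qed
  then have "A *v v = m *\<^sub>R v" by (simp add: c_def w_def)
  moreover have "v \<noteq> 0" using vv by auto
  ultimately show thesis using lower that by blast
qed

lemma nth_eigenvalue_1_eqI:
  assumes "v \<noteq> 0" "A *v v = m *\<^sub>R v" and lower: "\<And>x. m * (x \<bullet> x) \<le> x \<bullet> (A *v x)"
  shows "nth_eigenvalue 1 A = m"
proof -
  let ?l = "eigenvalues_asc A"
  have m: "m \<in> set ?l"
    using assms by (auto simp: set_eigenvalues_asc)
  have "m \<le> l" if l: "l \<in> set ?l" for l
  proof -
    obtain u where "u \<noteq> 0" "A *v u = l *\<^sub>R u"
      using l by (auto simp: set_eigenvalues_asc)
    then show ?thesis using lower[of u] by simp
  qed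
  moreover have "?l \<noteq> []"
    using m by auto
  then have "?l ! 0 \<in> set ?l"
    by simp
  moreover have "sorted ?l"
    by (simp add: eigenvalues_asc_def)
  then have "?l ! 0 \<le> m"
    using m by (metis in_set_conv_nth le0 sorted_nth_mono)
  ultimately show ?thesis
    by (force simp: nth_eigenvalue_def)
qed

lemma nth_eigenvalue_1_mono:
  fixes A B :: "real^'n^'n"
  assumes "transpose A = A" "transpose B = B"
    and le: "\<And>x. x \<bullet> (A *v x) \<le> x \<bullet> (B *v x)"
  shows "nth_eigenvalue 1 A \<le> nth_eigenvalue 1 B"
proof -
  obtain u a where A: "u \<noteq> 0" "A *v u = a *\<^sub>R u" "\<And>x. a * (x \<bullet> x) \<le> x \<bullet> (A *v x)"
    using symmetric_min_eigenvector[OF assms(1)] by blast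
  obtain v b where B: "v \<noteq> 0" "B *v v = b *\<^sub>R v" "\<And>x. b * (x \<bullet> x) \<le> x \<bullet> (B *v x)"
    using symmetric_min_eigenvector[OF assms(2)] by blast
  have "a * (v \<bullet> v) \<le> b * (v \<bullet> v)"
    using A(3)[of v] le[of v] B(2) by simp
  then have "a \<le> b" using B(1) by simp
  then show ?thesis
    by (simp only: nth_eigenvalue_1_eqI[OF A] nth_eigenvalue_1_eqI[OF B])
qed

lemma transpose_gain_cov:
  assumes "transpose P = P" "transpose R = R"
  shows "transpose (gain_cov P R H K) = gain_cov P R H K"
  by (simp add: gain_cov_def transpose_add matrix_transpose_mul assms matrix_mul_assoc)

lemma inner_gain_cov:
  fixes P :: "real^'n^'n" and R :: "real^'m^'m" and H :: "real^'n^'m" and x :: "real^'n"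
  defines "y \<equiv> \<lambda>u. x - transpose H *v u"
  shows "x \<bullet> (gain_cov P R H K *v x) =
    (let u = transpose K *v x in y u \<bullet> (P *v y u) + u \<bullet> (R *v u))"
proof -
  have y: "transpose (mat 1 - K ** H) *v x = y (transpose K *v x)"
    by (simp only: y_def transpose_diff transpose_mat matrix_transpose_mul
        matrix_vector_mult_diff_rdistrib matrix_vector_mul_lid matrix_vector_mul_assoc)
  have sandwich: "x \<bullet> ((L ** Q ** transpose L) *v x) = (transpose L *v x) \<bullet> (Q *v (transpose L *v x))"
    for L :: "real^'k^'n" and Q
    by (simp only: inner_matrix_vector_transpose[of x L] flip: matrix_vector_mul_assoc)
  show ?thesis
    by (simp only: gain_cov_def matrix_vector_mult_add_rdistrib inner_add_right sandwich y Let_def)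
qed

lemma sym_pos_def_innovation_cov:
  fixes P :: "real^'n^'n" and R :: "real^'m^'m" and H :: "real^'n^'m"
  assumes "sym_pos_def P" and "sym_pos_def R"
  shows "sym_pos_def (H ** P ** transpose H + R)"
proof -
  have form: "x \<bullet> ((H ** P ** transpose H + R) *v x) =
      (transpose H *v x) \<bullet> (P *v (transpose H *v x)) + x \<bullet> (R *v x)" for x
    by (simp only: matrix_vector_mult_add_rdistrib inner_add_right
        inner_matrix_vector_transpose[of x H] flip: matrix_vector_mul_assoc)
  have "0 \<le> z \<bullet> (P *v z)" for z
    using assms(1) unfolding sym_pos_def_def by (cases "z = 0") (auto simp: less_imp_le)
  then have "0 < x \<bullet> ((H ** P ** transpose H + R) *v x)" if "x \<noteq> 0" for x
    using that assms(2) unfolding form sym_pos_def_def by (simp add: add_nonneg_pos)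
  then show ?thesis
    using assms unfolding sym_pos_def_def
    by (simp add: transpose_add matrix_transpose_mul matrix_mul_assoc)
qed

lemma matrix_inv_mult_left:
  assumes "invertible A"
  shows "matrix_inv A ** A = mat 1"
  using assms unfolding invertible_def matrix_inv_def by (rule someI2_ex) simp

lemma sym_pos_def_invertible:
  assumes "sym_pos_def A"
  shows "invertible A"
proof -
  have "x = 0" if "A *v x = 0" for x
    using assms that unfolding sym_pos_def_def by force
  then show ?thesis
    by (simp add: invertible_left_inverse matrix_left_invertible_ker)
qed

text \<open>
  The normal equation: \<open>(K\<^sup>*)\<^sup>T x\<close> is the critical point of \<open>J\<^sub>x\<close>. It holds because
  \<open>(K\<^sup>*)\<^sup>T = S\<^sup>-\<^sup>1 H P\<close> by the symmetry of \<open>P\<close> and \<open>S\<close>.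
\<close>

lemma kalman_gain_normal_equation:
  fixes P :: "real^'n^'n" and R :: "real^'m^'m" and H :: "real^'n^'m"
  assumes "sym_pos_def P" and "sym_pos_def R"
  shows "(H ** P ** transpose H + R) *v (transpose (kalman_gain P R H) *v x) = H *v (P *v x)"
proof -
  let ?S = "H ** P ** transpose H + R"
  have S: "sym_pos_def ?S"
    by (rule sym_pos_def_innovation_cov[OF assms])
  have "transpose (matrix_inv ?S ** ?S) = mat 1"
    by (simp only: matrix_inv_mult_left[OF sym_pos_def_invertible[OF S]] transpose_mat)
  then have inv: "?S ** transpose (matrix_inv ?S) = mat 1"
    using S unfolding matrix_transpose_mul sym_pos_def_def by simp
  have P: "transpose P = P"
    using assms(1) by (simp add: sym_pos_def_def)
  have "transpose (kalman_gain P R H) = transpose (matrix_inv ?S) ** (H ** P)"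
    by (simp only: kalman_gain_def matrix_transpose_mul transpose_transpose P matrix_mul_assoc)
  then have "?S ** transpose (kalman_gain P R H) = H ** P"
    by (simp only: matrix_mul_assoc[symmetric, of ?S] inv matrix_mul_assoc[of ?S] matrix_mul_lid)
  then show ?thesis
    by (metis matrix_vector_mul_assoc)
qed

text \<open>
  Expanding \<open>J\<^sub>x\<close> about its critical point \<open>u\<close>, the linear term in the displacement \<open>d\<close>
  vanishes by the normal equation, and the quadratic term \<open>d \<bullet> S d\<close> is nonnegative.
\<close>

lemma gain_cov_kalman_gain_le:
  fixes P :: "real^'n^'n" and R :: "real^'m^'m" and H :: "real^'n^'m"
  assumes "sym_pos_def P" and "sym_pos_def R"
  shows "x \<bullet> (gain_cov P R H (kalman_gain P R H) *v x) \<le> x \<bullet> (gain_cov P R H K *v x)"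
proof -
  define u where "u = transpose (kalman_gain P R H) *v x"
  define d where "d = transpose K *v x - u"
  define z where "z = x - transpose H *v u"
  define h where "h = transpose H *v d"
  have sym: "transpose P = P" "transpose R = R"
    using assms by (simp_all add: sym_pos_def_def)
  have nonneg: "0 \<le> h \<bullet> (P *v h)" "0 \<le> d \<bullet> (R *v d)"
    using assms unfolding sym_pos_def_def by (metis inner_zero_left less_imp_le order_refl)+
  have "H *v (P *v (transpose H *v u)) + R *v u = H *v (P *v x)"
    using kalman_gain_normal_equation[OF assms, of H x]
    by (simp only: u_def[symmetric] matrix_vector_mult_add_rdistrib flip: matrix_vector_mul_assoc)
  then have "R *v u = H *v (P *v z)"
    unfolding z_def matrix_vector_mult_diff_distrib by (simp add: algebra_simps)
  then have crit: "d \<bullet> (R *v u) = h \<bullet> (P *v z)"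
    by (simp only: inner_matrix_vector_transpose[of d H] h_def)
  have K: "transpose K *v x = u + d" "x - transpose H *v (u + d) = z - h"
    by (simp_all add: d_def z_def h_def matrix_vector_right_distrib matrix_vector_mult_diff_distrib)
  have "x \<bullet> (gain_cov P R H K *v x) = (z - h) \<bullet> (P *v (z - h)) + (u + d) \<bullet> (R *v (u + d))"
    by (simp only: inner_gain_cov K Let_def)
  also have "\<dots> = z \<bullet> (P *v z) + u \<bullet> (R *v u) + (h \<bullet> (P *v h) + d \<bullet> (R *v d))"
    using crit inner_symmetric_matrix[OF sym(1), of z h] inner_symmetric_matrix[OF sym(2), of u d]
    by (simp add: matrix_vector_right_distrib matrix_vector_mult_diff_distrib
        inner_diff_left inner_diff_right inner_add_left inner_add_right)
  also have "\<dots> \<ge> z \<bullet> (P *v z) + u \<bullet> (R *v u)"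
    using nonneg by simp
  also have "z \<bullet> (P *v z) + u \<bullet> (R *v u) = x \<bullet> (gain_cov P R H (kalman_gain P R H) *v x)"
    by (simp only: inner_gain_cov u_def z_def Let_def)
  finally show ?thesis .
qed

theorem corollary1p1:
  fixes P :: "real^'n^'n" and R :: "real^'m^'m" and H :: "real^'n^'m"
  assumes "sym_pos_def P" and "sym_pos_def R"
  shows "\<forall>K :: real^'m^'n.
    nth_eigenvalue 1 (gain_cov P R H (kalman_gain P R H))
      \<le> nth_eigenvalue 1 (gain_cov P R H K)"
proof
  fix K :: "real^'m^'n"
  have "transpose P = P" "transpose R = R"
    using assms by (simp_all add: sym_pos_def_def)
  then show "nth_eigenvalue 1 (gain_cov P R H (kalman_gain P R H))
      \<le> nth_eigenvalue 1 (gain_cov P R H K)"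
    by (intro nth_eigenvalue_1_mono transpose_gain_cov gain_cov_kalman_gain_le assms)
qed

end
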